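(* Let $n,d\ge1$ and let $S$ be a $d$-independent set of $k$ points in $\mathbb{R}^n$. Then $$\dim Pos_{n,2d}(S)\ \ge\ \binom{n+2d-1}{2d}-kn\qquad\text{and}\qquad \dim Sq_{n,2d}(S)\ \le\ \binom{\binom{n+d-1}{d}-k+1}{2}.$$
   Context: $P_{n,m}$ denotes the real vector space of forms in $n$ variables of degree $m$ with real coefficients. $Pos_{n,2d}=\{p\in P_{n,2d} : p(x)\ge0\ \forall x\in\mathbb{R}^n\}$ and $Sq_{n,2d}=\{p\in P_{n,2d} : p=\sum q_i^2 \text{ (finite sum) for some } q_i\in P_{n,d}\}$. Finite sets $S\subset\mathbb{R}^n$ consist of nonzero vectors and are thought of projectively, i.e. as sets of distinct points of $\mathbb{RP}^{n-1}$. Define $Pos_{n,2d}(S)=\{p\in Pos_{n,2d} : p(s)=0\ \forall s\in S\}$, $Sq_{n,2d}(S)=\{p\in Sq_{n,2d} : p(s)=0\ \forall s\in S\}$ and $I_{1,d}(S)=\{p\in P_{n,d} : p(s)=0\ \forall s\in S\}$. The dimension of a convex cone is the dimension of its linear span. A form vanishes to order 2 at $s$ if all its first partial derivatives vanish at $s$. A finite set $S$ is called $d$-independent if: (1) $S$ forces no additional zeroes for forms of degree $d$ that vanish on $S$, i.e. the set of common zeroes in $\mathbb{RP}^{n-1}$ of the forms in $I_{1,d}(S)$ is exactly $S$; and (2) for every $s\in S$, the forms in $P_{n,d}$ that vanish to order 2 at $s$ and vanish on the rest of $S$ form a vector subspace of codimension $|S|+n-1$ in $P_{n,d}$. *)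

theory Defs
  imports "HOL-Analysis.Analysis" "HOL-Library.Function_Algebras"
begin

text \<open>
  Since \<open>\<real>\<close> is infinite, a real form is determined by its values, so forms in \<open>n\<close> variables are
  represented as polynomial functions on \<open>real ^ 'n\<close>, with \<open>n = CARD('n)\<close>.  The libraries have no
  \<open>real_vector\<close> instance for functions; linear algebra on them is obtained from the locale
  \<open>vector_space\<close> with pointwise scalar multiplication.
\<close>

definition fun_scale :: "real \<Rightarrow> ('a \<Rightarrow> real) \<Rightarrow> ('a \<Rightarrow> real)" where
  "fun_scale c f = (\<lambda>x. c * f x)"

global_interpretation fun_vs: vector_space "fun_scale :: real \<Rightarrow> ('a \<Rightarrow> real) \<Rightarrow> ('a \<Rightarrow> real)"
  by unfold_locales (auto simp: fun_scale_def fun_eq_iff plus_fun_def algebra_simps)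

definition monomial_fun :: "('n::finite \<Rightarrow> nat) \<Rightarrow> real ^ 'n \<Rightarrow> real" where
  "monomial_fun a = (\<lambda>x. \<Prod>i\<in>UNIV. (x $ i) ^ a i)"

definition forms :: "nat \<Rightarrow> (real ^ 'n::finite \<Rightarrow> real) set" where
  "forms m = fun_vs.span {monomial_fun a | a. (\<Sum>i\<in>UNIV. a i) = m}"

text \<open>
  The parameter \<open>d\<close> of the next two cones is half the degree: they consist of forms of degree \<open>2 * d\<close>.
\<close>

definition Pos :: "nat \<Rightarrow> (real ^ 'n::finite \<Rightarrow> real) set" where
  "Pos d = {p \<in> forms (2 * d). \<forall>x. p x \<ge> 0}"

definition Sq :: "nat \<Rightarrow> (real ^ 'n::finite \<Rightarrow> real) set" where
  "Sq d = {p \<in> forms (2 * d).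
     \<exists>(N::nat) q. (\<forall>i<N. q i \<in> forms d) \<and> p = (\<lambda>x. \<Sum>i<N. (q i x)\<^sup>2)}"

definition vanishing_on :: "(real ^ 'n::finite) set \<Rightarrow> (real ^ 'n \<Rightarrow> real) set" where
  "vanishing_on S = {p. \<forall>s\<in>S. p s = 0}"

definition Pos_at :: "nat \<Rightarrow> (real ^ 'n::finite) set \<Rightarrow> (real ^ 'n \<Rightarrow> real) set" where
  "Pos_at d S = Pos d \<inter> vanishing_on S"

definition Sq_at :: "nat \<Rightarrow> (real ^ 'n::finite) set \<Rightarrow> (real ^ 'n \<Rightarrow> real) set" where
  "Sq_at d S = Sq d \<inter> vanishing_on S"

definition I1 :: "nat \<Rightarrow> (real ^ 'n::finite) set \<Rightarrow> (real ^ 'n \<Rightarrow> real) set" where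
  "I1 d S = forms d \<inter> vanishing_on S"

definition cone_dim :: "(real ^ 'n::finite \<Rightarrow> real) set \<Rightarrow> nat" where
  "cone_dim C = fun_vs.dim (fun_vs.span C)"

definition vanishes_order2 :: "(real ^ 'n::finite \<Rightarrow> real) \<Rightarrow> real ^ 'n \<Rightarrow> bool" where
  "vanishes_order2 p s \<longleftrightarrow>
     (\<forall>i. ((\<lambda>t. p (s + t *\<^sub>R axis i 1)) has_real_derivative 0) (at 0))"

text \<open>
  The point of \<open>\<real>\<P>\<^sup>n\<^sup>-\<^sup>1\<close> represented by a nonzero vector \<open>x\<close> is the line \<open>span {x}\<close>.
\<close>

definition proj_point :: "real ^ 'n::finite \<Rightarrow> (real ^ 'n) set" where
  "proj_point x = span {x}"

definition projective_points :: "(real ^ 'n::finite) set \<Rightarrow> bool" where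
  "projective_points S \<longleftrightarrow> finite S \<and> 0 \<notin> S \<and> inj_on proj_point S"

definition common_zeros :: "(real ^ 'n::finite \<Rightarrow> real) set \<Rightarrow> (real ^ 'n) set set" where
  "common_zeros F = {proj_point x | x. x \<noteq> 0 \<and> (\<forall>p\<in>F. p x = 0)}"

text \<open>
  The codimension condition is stated additively; both spaces are finite-dimensional, being
  subspaces of the span of the finitely many monomials of degree \<open>d\<close>.
\<close>

definition d_independent :: "nat \<Rightarrow> (real ^ 'n::finite) set \<Rightarrow> bool" where
  "d_independent d S \<longleftrightarrow>
     projective_points S \<and>
     common_zeros (I1 d S) = proj_point ` S \<and>
     (\<forall>s\<in>S. fun_vs.dim {p \<in> forms d. vanishes_order2 p s \<and> p \<in> vanishing_on (S - {s})}
               + (card S + CARD('n) - 1)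
             = fun_vs.dim (forms d :: (real ^ 'n \<Rightarrow> real) set))"

end

theory Submission
  imports Defs
begin

text \<open>
  Both bounds are dimension counts. On the side of sums of squares, if \<open>p = \<Sum> q_i\<^sup>2\<close> vanishes on \<open>S\<close> then
  every \<open>q_i\<close> does, so \<open>p\<close> lies in the span of the pairwise products of a basis of \<open>I1 d S\<close>
  (\<open>dim_Sq_at_le\<close>). There are at most \<open>(m + 1 choose 2)\<close> such products, where \<open>m = dim (I1 d S)\<close>, and
  independence forces \<open>m = dim (forms d) - k\<close> (\<open>dim_I1\<close>).

  On the side of nonnegative forms, consider the space \<open>W\<close> of all forms of degree \<open>2 d\<close> whose gradient
  vanishes at every point of \<open>S\<close>. It is cut out by \<open>k n\<close> linear conditions, so its codimension is at
  most \<open>k n\<close> (\<open>dim_singular_forms_ge\<close>), and the point is that \<open>W\<close> is contained in the linear span of the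
  cone (\<open>singular_forms_subset_span_Pos_at\<close>). For this it is enough to find one form \<open>p\<close> in the cone
  that can be perturbed slightly in every direction \<open>w\<close> of \<open>W\<close>. Take for \<open>p\<close> the sum of the squares of a
  basis of \<open>I1 d S\<close>. By the first condition of independence, \<open>p\<close> is positive away from the lines through
  \<open>S\<close>. By the second condition, the gradients at \<open>s \<in> S\<close> of the forms in \<open>I1 d S\<close> span the hyperplane
  orthogonal to \<open>s\<close> (\<open>ex_transversal_gradient\<close>), so \<open>p\<close> grows quadratically when leaving \<open>s\<close> transversally,
  whereas \<open>w\<close> grows at most quadratically. Compactness of the unit sphere then gives \<open>e > 0\<close> with
  \<open>e |w| \<le> p\<close> everywhere (\<open>sum_squares_dominates\<close>).

  The spaces of forms have the expected dimension since distinct monomials are distinct characters of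
  the multiplicative monoid \<open>\<real>^n\<close>, hence linearly independent (\<open>dim_forms\<close>).
\<close>

section \<open>Kernels of finitely many functionals\<close>

text \<open>
  A space without a finite basis has dimension \<open>0\<close> by convention, and the space of all functions on
  \<open>\<real>^n\<close> is of this
  kind. Monotonicity of the dimension therefore needs a finite spanning set, here and below.
\<close>

lemma (in vector_space) dim_mono_finite_span:
  assumes "V \<subseteq> span W" "W \<subseteq> span F" "finite F"
  shows "dim V \<le> dim W"
proof -
  obtain B where B: "B \<subseteq> W" "independent B" "W \<subseteq> span B" "card B = dim W"
    using basis_exists by blast
  have "finite B"
    using independent_span_bound[OF assms(3) B(2)] B(1) assms(2) by blast
  moreover have "V \<subseteq> span B"
    using assms(1) B(3) by (metis span_minimal subspace_span subset_trans)
  ultimately show ?thesis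
    using dim_le_card B(4) by metis
qed

lemma (in vector_space) dim_le_dim_kernel_Suc:
  assumes V: "subspace V" "V \<subseteq> span F" "finite F"
    and add: "\<And>u v. u \<in> V \<Longrightarrow> v \<in> V \<Longrightarrow> \<phi> (u + v) = \<phi> u + \<phi> v"
    and scale: "\<And>c v. v \<in> V \<Longrightarrow> \<phi> (scale c v) = c * \<phi> v"
  shows "dim V \<le> Suc (dim {v \<in> V. \<phi> v = 0})"
proof -
  let ?K = "{v \<in> V. \<phi> v = 0}"
  obtain B where B: "B \<subseteq> ?K" "independent B" "?K \<subseteq> span B" "card B = dim ?K"
    using basis_exists by blast
  have fin: "finite B"
    using independent_span_bound[OF V(3) B(2)] B(1) V(2) by blast
  show ?thesis
  proof (cases "V = ?K")
    case True
    then show ?thesis by simp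
  next
    case False
    then obtain w where w: "w \<in> V" "\<phi> w \<noteq> 0" by blast
    have "V \<subseteq> span (insert w B)"
    proof
      fix v assume v: "v \<in> V"
      \<comment> \<open>With this choice \<open>\<phi>\<close> vanishes on \<open>v + c w\<close>.\<close>
      define c where "c = - (\<phi> v / \<phi> w)"
      have cw: "scale c w \<in> V" using V(1) w(1) by (rule subspace_scale)
      have "\<phi> (v + scale c w) = 0"
        using v w by (simp add: add[OF v cw] scale) (simp add: c_def)
      moreover have "v + scale c w \<in> V"
        using V(1) v cw by (rule subspace_add)
      ultimately have "v + scale c w \<in> span B" using B(3) by blast
      then have "v + scale c w \<in> span (insert w B)"
        using span_mono[of B "insert w B"] by blast
      moreover have "scale c w \<in> span (insert w B)"
        by (intro span_scale span_base) simp
      ultimately have "v + scale c w - scale c w \<in> span (insert w B)"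
        by (rule span_diff)
      then show "v \<in> span (insert w B)" by simp
    qed
    then have "dim V \<le> card (insert w B)"
      using dim_le_card fin by blast
    then show ?thesis using fin B(4) by (simp add: card_insert_if split: if_splits)
  qed
qed

text \<open>
  Imposing one linear equation lowers the dimension by at most one. The functionals are required to be
  linear on \<open>V\<close> only: evaluating derivatives is linear on forms but not on arbitrary functions.
\<close>

lemma (in vector_space) dim_le_dim_kernel_add_card:
  assumes V: "subspace V" "V \<subseteq> span F" "finite F" and "finite J"
    and add: "\<And>j u v. j \<in> J \<Longrightarrow> u \<in> V \<Longrightarrow> v \<in> V \<Longrightarrow> \<phi> j (u + v) = \<phi> j u + \<phi> j v"
    and scale: "\<And>j c v. j \<in> J \<Longrightarrow> v \<in> V \<Longrightarrow> \<phi> j (scale c v) = c * \<phi> j v"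
  shows "dim V \<le> dim {v \<in> V. \<forall>j\<in>J. \<phi> j v = 0} + card J"
  using \<open>finite J\<close> add scale
proof (induction J)
  case empty
  then show ?case by simp
next
  case (insert i J)
  let ?K = "{v \<in> V. \<forall>j\<in>J. \<phi> j v = 0}"
  have "\<phi> j 0 = 0" if "j \<in> insert i J" for j
    using insert.prems(2)[of j 0 0] that subspace_0[OF V(1)] by simp
  then have K: "subspace ?K"
    using V(1) insert.prems unfolding subspace_def by auto
  have "dim ?K \<le> Suc (dim {v \<in> ?K. \<phi> i v = 0})"
    using K V insert.prems by (intro dim_le_dim_kernel_Suc[of _ F]) auto
  moreover have "{v \<in> ?K. \<phi> i v = 0} = {v \<in> V. \<forall>j\<in>insert i J. \<phi> j v = 0}"
    by auto
  moreover have "dim V \<le> dim ?K + card J"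
    using insert.prems by (intro insert.IH) auto
  ultimately show ?case using insert.hyps by simp
qed

section \<open>Products of functions and the dimension of the space of forms\<close>

lemma sum_fun_apply: "(sum f A) x = (\<Sum>a\<in>A. f a x)" for f :: "'a \<Rightarrow> 'b \<Rightarrow> real"
  by (induction A rule: infinite_finite_induct) auto

text \<open>
  Multiplication is bilinear, so it suffices to control products of generators.
\<close>

lemma times_in_span:
  fixes f g :: "'a \<Rightarrow> real"
  assumes "f \<in> fun_vs.span A" "g \<in> fun_vs.span B"
    and AB: "\<And>a b. a \<in> A \<Longrightarrow> b \<in> B \<Longrightarrow> a * b \<in> fun_vs.span C"
  shows "f * g \<in> fun_vs.span C"
  using assms(1)
proof (induction rule: fun_vs.span_induct_alt)
  case base
  have "0 * g = 0" by (simp add: fun_eq_iff)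
  then show ?case using fun_vs.span_zero by metis
next
  case (step c a y)
  have "a * g \<in> fun_vs.span C"
    using assms(2)
  proof (induction rule: fun_vs.span_induct_alt)
    case base
    have "a * 0 = 0" by (simp add: fun_eq_iff)
    then show ?case using fun_vs.span_zero by metis
  next
    case (step e b z)
    have "a * (fun_scale e b + z) = fun_scale e (a * b) + a * z"
      by (simp add: fun_eq_iff fun_scale_def algebra_simps)
    moreover have "fun_scale e (a * b) + a * z \<in> fun_vs.span C"
      using step AB[OF \<open>a \<in> A\<close>] by (intro fun_vs.span_add fun_vs.span_scale)
    ultimately show ?case by metis
  qed
  moreover have "(fun_scale c a + y) * g = fun_scale c (a * g) + y * g"
    by (simp add: fun_eq_iff fun_scale_def algebra_simps)
  moreover have "fun_scale c (a * g) + y * g \<in> fun_vs.span C"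
    using step \<open>a * g \<in> fun_vs.span C\<close> by (intro fun_vs.span_add fun_vs.span_scale)
  ultimately show ?case by metis
qed

text \<open>
  By commutativity the products are indexed by unordered pairs with repetition. Adding a new element
  \<open>x\<close> to \<open>B\<close> contributes only the products of \<open>x\<close> with the \<open>card B + 1\<close> elements now present.
\<close>

lemma card_pairwise_products_le:
  fixes B :: "'a::ab_semigroup_mult set"
  assumes "finite B"
  shows "card {a * b | a b. a \<in> B \<and> b \<in> B} \<le> (card B + 1) choose 2"
  using assms
proof (induction B)
  case empty
  then show ?case by simp
next
  case (insert x B)
  let ?P = "{a * b | a b. a \<in> B \<and> b \<in> B}"
  have "?P = (\<lambda>(a, b). a * b) ` (B \<times> B)" by auto
  then have fin: "finite ?P" using insert.hyps by simp
  have "{a * b | a b. a \<in> insert x B \<and> b \<in> insert x B} \<subseteq> ?P \<union> (*) x ` insert x B"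
    using mult.commute by blast
  then have "card {a * b | a b. a \<in> insert x B \<and> b \<in> insert x B} \<le> card (?P \<union> (*) x ` insert x B)"
    using fin insert.hyps by (intro card_mono) auto
  also have "\<dots> \<le> card ?P + card ((*) x ` insert x B)" by (rule card_Un_le)
  also have "\<dots> \<le> ((card B + 1) choose 2) + card (insert x B)"
    using insert by (intro add_mono card_image_le) auto
  also have "\<dots> = (card (insert x B) + 1) choose 2"
    using insert.hyps by (simp add: numeral_2_eq_2)
  finally show ?case .
qed

text \<open>
  Dedekind's independence of characters. Given a relation, subtracting \<open>g y\<close> times the relation at \<open>x\<close>
  from the relation at \<open>y * x\<close> eliminates \<open>g\<close> and multiplies each other coefficient by \<open>h y - g y\<close>;
  choosing \<open>y\<close> to separate \<open>h\<close> from \<open>g\<close> lets the induction hypothesis kill the coefficient of \<open>h\<close>.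
  Monomials are multiplicative for the componentwise product, so this makes them independent.
\<close>

lemma multiplicative_functions_independent:
  fixes C :: "('a::{times,one} \<Rightarrow> real) set"
  assumes "finite C"
    and mult: "\<And>h x y. h \<in> C \<Longrightarrow> h (x * y) = h x * h y"
    and one: "\<And>h. h \<in> C \<Longrightarrow> h 1 = 1"
    and zero: "\<And>x. (\<Sum>h\<in>C. c h * h x) = 0"
    and "h \<in> C"
  shows "c h = 0"
  using assms
proof (induction C arbitrary: c h)
  case empty
  then show ?case by simp
next
  case (insert g C)
  have rest: "c h = 0" if "h \<in> C" for h
  proof -
    have "h \<noteq> g" using that insert.hyps by blast
    then obtain y where y: "h y \<noteq> g y" by (auto simp: fun_eq_iff)
    have "c h * (h y - g y) = 0"
    proof (rule insert.IH[where c = "\<lambda>h. c h * (h y - g y)"])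
      fix x
      have "(\<Sum>h\<in>C. c h * (h y - g y) * h x)
          = (\<Sum>h\<in>insert g C. c h * (h y - g y) * h x)"
        using insert.hyps by simp
      also have "\<dots> = (\<Sum>h\<in>insert g C. c h * h (y * x)) - g y * (\<Sum>h\<in>insert g C. c h * h x)"
        unfolding sum_distrib_left sum_subtractf[symmetric]
        by (intro sum.cong refl) (simp add: insert.prems(1) algebra_simps)
      also have "\<dots> = 0" using insert.prems(3) by simp
      finally show "(\<Sum>h\<in>C. c h * (h y - g y) * h x) = 0" .
    qed (use insert.prems that in auto)
    then show ?thesis using y by simp
  qed
  have "(\<Sum>h\<in>insert g C. c h * h 1) = c g"
    using insert.hyps insert.prems(2) by (simp add: rest)
  then have "c g = 0" using insert.prems(3) by simp
  then show ?case using rest insert.prems(4) by blast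
qed

lemma monomial_fun_mult: "monomial_fun a (x * y) = monomial_fun a x * monomial_fun a y"
  by (simp add: monomial_fun_def power_mult_distrib prod.distrib)

lemma monomial_fun_one: "monomial_fun a 1 = 1"
  by (simp add: monomial_fun_def)

lemma inj_monomial_fun: "inj (monomial_fun :: ('n::finite \<Rightarrow> nat) \<Rightarrow> _)"
proof (rule injI)
  fix a b :: "'n \<Rightarrow> nat"
  assume eq: "monomial_fun a = monomial_fun b"
  show "a = b"
  proof
    fix i
    \<comment> \<open>A point with \<open>2\<close> in position \<open>i\<close> and \<open>1\<close> elsewhere isolates the exponent of the \<open>i\<close>-th variable.\<close>
    have "monomial_fun e (\<chi> j. if j = i then 2 else 1) = 2 ^ e i" for e :: "'n \<Rightarrow> nat"
    proof -
      have "monomial_fun e (\<chi> j. if j = i then 2 else 1) = (\<Prod>j\<in>UNIV. if j = i then 2 ^ e i else 1)"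
        unfolding monomial_fun_def by (intro prod.cong) auto
      then show ?thesis by simp
    qed
    then have "(2::real) ^ a i = 2 ^ b i" using eq by metis
    then show "a i = b i" by simp
  qed
qed

text \<open>
  Listing the variables turns exponent functions into weak compositions of \<open>m\<close> into \<open>n\<close> parts, which
  are counted by stars and bars.
\<close>

lemma card_exponents:
  "card {a :: 'n::finite \<Rightarrow> nat. (\<Sum>i\<in>UNIV. a i) = m} = (CARD('n) + m - 1) choose m"
proof -
  obtain xs :: "'n list" where xs: "set xs = UNIV" "distinct xs"
    using finite_distinct_list[of "UNIV :: 'n set"] by auto
  have len: "length xs = CARD('n)" using xs by (metis distinct_card)
  have "bij_betw (\<lambda>a. map a xs) {a. (\<Sum>i\<in>UNIV. a i) = m}
          {l :: nat list. length l = CARD('n) \<and> sum_list l = m}"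
    unfolding bij_betw_def
  proof
    show "inj_on (\<lambda>a. map a xs) {a. (\<Sum>i\<in>UNIV. a i) = m}"
      using xs(1) by (intro inj_onI) (auto simp: fun_eq_iff)
    show "(\<lambda>a. map a xs) ` {a. (\<Sum>i\<in>UNIV. a i) = m} = {l. length l = CARD('n) \<and> sum_list l = m}"
    proof (intro equalityI subsetI)
      fix l assume "l \<in> (\<lambda>a. map a xs) ` {a. (\<Sum>i\<in>UNIV. a i) = m}"
      then show "l \<in> {l. length l = CARD('n) \<and> sum_list l = m}"
        using xs len by (auto simp: sum_list_distinct_conv_sum_set)
    next
      fix l assume "l \<in> {l :: nat list. length l = CARD('n) \<and> sum_list l = m}"
      then have l: "length l = length xs" "sum_list l = m" using len by auto
      define a where "a = (\<lambda>x. the (map_of (zip xs l) x))"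
      have a: "l = map a xs"
        using l(1) xs(2) by (intro nth_equalityI) (auto simp: a_def map_of_zip_nth)
      then have "(\<Sum>i\<in>UNIV. a i) = m"
        using l(2) xs by (simp add: sum_list_distinct_conv_sum_set)
      then show "l \<in> (\<lambda>a. map a xs) ` {a. (\<Sum>i\<in>UNIV. a i) = m}" using a by blast
    qed
  qed
  then show ?thesis
    by (simp add: bij_betw_same_card card_length_sum_list add.commute)
qed

abbreviation monomials :: "nat \<Rightarrow> (real ^ 'n::finite \<Rightarrow> real) set" where
  "monomials m \<equiv> {monomial_fun a | a. (\<Sum>i\<in>UNIV. a i) = m}"

lemma card_monomials: "card (monomials m :: (real ^ 'n::finite \<Rightarrow> real) set) = (CARD('n) + m - 1) choose m"
proof -
  have "monomials m = monomial_fun ` {a :: 'n \<Rightarrow> nat. (\<Sum>i\<in>UNIV. a i) = m}" by auto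
  then show ?thesis
    by (simp add: card_exponents card_image inj_on_subset[OF inj_monomial_fun])
qed

lemma finite_monomials: "finite (monomials m :: (real ^ 'n::finite \<Rightarrow> real) set)"
proof -
  \<comment> \<open>The cardinality is a nonzero binomial coefficient, whereas an infinite set would have cardinality \<open>0\<close>.\<close>
  have "m \<le> CARD('n) + m - 1"
    using zero_less_card_finite[where 'a = 'n] by linarith
  then have "card (monomials m :: (real ^ 'n \<Rightarrow> real) set) > 0"
    unfolding card_monomials by (rule zero_less_binomial)
  then show ?thesis by (simp add: card_gt_0_iff)
qed

lemma dim_forms:
  "fun_vs.dim (forms m :: (real ^ 'n::finite \<Rightarrow> real) set) = (CARD('n) + m - 1) choose m"
proof -
  have "fun_vs.independent (monomials m :: (real ^ 'n \<Rightarrow> real) set)"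
  proof (rule fun_vs.independent_if_scalars_zero[OF finite_monomials])
    fix c :: "(real ^ 'n \<Rightarrow> real) \<Rightarrow> real" and h :: "real ^ 'n \<Rightarrow> real"
    assume "(\<Sum>h\<in>monomials m. fun_scale (c h) h) = 0" and h: "h \<in> monomials m"
    then have zero: "(\<Sum>h\<in>monomials m. c h * h x) = 0" for x
      by (metis (mono_tags, lifting) fun_scale_def sum.cong sum_fun_apply zero_fun_apply)
    show "c h = 0"
      by (rule multiplicative_functions_independent[OF finite_monomials _ _ zero h])
        (auto simp: monomial_fun_mult monomial_fun_one)
  qed
  then show ?thesis
    by (simp add: forms_def fun_vs.dim_eq_card_independent card_monomials)
qed

lemma subspace_forms: "fun_vs.subspace (forms m)"
  by (simp add: forms_def)

lemma forms_times: "f \<in> forms k \<Longrightarrow> g \<in> forms m \<Longrightarrow> f * g \<in> forms (k + m)"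
  unfolding forms_def
proof (rule times_in_span, assumption, assumption)
  fix f g :: "real ^ 'n \<Rightarrow> real"
  assume "f \<in> monomials k" "g \<in> monomials m"
  then obtain a b where ab: "f = monomial_fun a" "g = monomial_fun b"
      "(\<Sum>i\<in>UNIV. a i) = k" "(\<Sum>i\<in>UNIV. b i) = m" by blast
  have "f * g = monomial_fun (\<lambda>i. a i + b i)"
    using ab by (simp add: fun_eq_iff monomial_fun_def power_add prod.distrib)
  then have "f * g \<in> monomials (k + m)"
    using ab by (auto simp: sum.distrib)
  then show "f * g \<in> fun_vs.span (monomials (k + m))" by (rule fun_vs.span_base)
qed

lemma forms_homogeneous:
  assumes "f \<in> forms m"
  shows "f (c *\<^sub>R x) = c ^ m * f x"
  using assms unfolding forms_def
proof (induction rule: fun_vs.span_induct_alt)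
  case base
  then show ?case by simp
next
  case (step e g y)
  then obtain a where a: "g = monomial_fun a" "(\<Sum>i\<in>UNIV. a i) = m" by blast
  have "g (c *\<^sub>R x) = c ^ m * g x"
    by (simp add: a(1) monomial_fun_def power_mult_distrib prod.distrib flip: a(2) power_sum)
  then show ?case using step by (simp add: fun_scale_def algebra_simps)
qed

section \<open>Gradients and quadratic remainders of forms\<close>

abbreviation grad :: "(real ^ 'n::finite \<Rightarrow> real) \<Rightarrow> real ^ 'n \<Rightarrow> real ^ 'n \<Rightarrow> real" where
  "grad f s \<equiv> frechet_derivative f (at s)"

text \<open>
  A first-order Taylor formula with quadratic remainder, with the linear part left existential. In this
  form the property passes to sums and products by elementary estimates, hence holds for all forms
  without any second derivatives; the linear part is identified with the derivative afterwards.
\<close>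

definition expands_at :: "('a::euclidean_space \<Rightarrow> real) \<Rightarrow> 'a \<Rightarrow> bool" where
  "expands_at f s \<longleftrightarrow> (\<exists>L C. linear L \<and> 
     (\<forall>v. norm v \<le> 1 \<longrightarrow> \<bar>f (s + v) - f s - L v\<bar> \<le> C * (norm v)\<^sup>2))"

lemma expands_at_const: "expands_at (\<lambda>x. c) s"
  unfolding expands_at_def
  by (intro exI[of _ "\<lambda>v. 0"] exI[of _ 0]) (simp add: linear_iff)

lemma expands_at_coordinate: "expands_at (\<lambda>x. x $ i) s"
  unfolding expands_at_def
  by (intro exI[of _ "\<lambda>v. v $ i"] exI[of _ 0]) (simp add: linear_iff)

lemma expands_at_add:
  assumes "expands_at f s" "expands_at g s"
  shows "expands_at (\<lambda>x. f x + g x) s"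
proof -
  obtain L C where L: "linear L"
      "\<And>v. norm v \<le> 1 \<Longrightarrow> \<bar>f (s + v) - f s - L v\<bar> \<le> C * (norm v)\<^sup>2"
    using assms(1) unfolding expands_at_def by blast
  obtain M D where M: "linear M"
      "\<And>v. norm v \<le> 1 \<Longrightarrow> \<bar>g (s + v) - g s - M v\<bar> \<le> D * (norm v)\<^sup>2"
    using assms(2) unfolding expands_at_def by blast
  show ?thesis
    unfolding expands_at_def
  proof (intro exI[of _ "\<lambda>v. L v + M v"] exI[of _ "C + D"] conjI allI impI)
    show "linear (\<lambda>v. L v + M v)"
      using L(1) M(1) by (rule linear_compose_add)
    fix v :: 'a assume "norm v \<le> 1"
    then show "\<bar>f (s + v) + g (s + v) - (f s + g s) - (L v + M v)\<bar> \<le> (C + D) * (norm v)\<^sup>2"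
      using L(2)[of v] M(2)[of v] unfolding distrib_right by linarith
  qed
qed

lemma expands_at_mult:
  assumes "expands_at f s" "expands_at g s"
  shows "expands_at (\<lambda>x. f x * g x) s"
proof -
  obtain L C where L: "linear L"
      "\<And>v. norm v \<le> 1 \<Longrightarrow> \<bar>f (s + v) - f s - L v\<bar> \<le> C * (norm v)\<^sup>2"
    using assms(1) unfolding expands_at_def by blast
  obtain M D where M: "linear M"
      "\<And>v. norm v \<le> 1 \<Longrightarrow> \<bar>g (s + v) - g s - M v\<bar> \<le> D * (norm v)\<^sup>2"
    using assms(2) unfolding expands_at_def by blast
  obtain BL where BL: "BL > 0" "\<And>v. \<bar>L v\<bar> \<le> BL * norm v"
    using linear_bounded_pos[OF L(1)] by (metis real_norm_def)
  obtain BM where BM: "BM > 0" "\<And>v. \<bar>M v\<bar> \<le> BM * norm v"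
    using linear_bounded_pos[OF M(1)] by (metis real_norm_def)
  define G where "G = \<bar>g s\<bar> + BM + \<bar>D\<bar>"
  have G: "\<bar>g (s + v)\<bar> \<le> G" "\<bar>g (s + v) - g s\<bar> \<le> (BM + \<bar>D\<bar>) * norm v" if v: "norm v \<le> 1" for v
  proof -
    have "D * (norm v)\<^sup>2 \<le> \<bar>D\<bar> * norm v"
      using v by (intro mult_mono) (auto simp: power2_eq_square mult_left_le)
    then show "\<bar>g (s + v) - g s\<bar> \<le> (BM + \<bar>D\<bar>) * norm v"
      using M(2)[OF v] BM(2)[of v] unfolding distrib_right by linarith
    also have "\<dots> \<le> BM + \<bar>D\<bar>"
      using v BM(1) by (simp add: mult_left_le)
    finally show "\<bar>g (s + v)\<bar> \<le> G" unfolding G_def by linarith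
  qed
  show ?thesis
    unfolding expands_at_def
  proof (intro exI[of _ "\<lambda>v. f s * M v + g s * L v"]
      exI[of _ "\<bar>C\<bar> * G + \<bar>f s\<bar> * \<bar>D\<bar> + BL * (BM + \<bar>D\<bar>)"] conjI allI impI)
    show "linear (\<lambda>v. f s * M v + g s * L v)"
      using L(1) M(1) by (simp add: linear_iff algebra_simps)
    fix v :: 'a assume v: "norm v \<le> 1"
    \<comment> \<open>The remainder of the product splits into three terms, each quadratically small.\<close>
    have "\<bar>(f (s + v) - f s - L v) * g (s + v)\<bar> \<le> (\<bar>C\<bar> * (norm v)\<^sup>2) * G"
      unfolding abs_mult
      by (intro mult_mono G(1)[OF v] order_trans[OF L(2)[OF v]] mult_right_mono) auto
    moreover have "\<bar>f s * (g (s + v) - g s - M v)\<bar> \<le> \<bar>f s\<bar> * (\<bar>D\<bar> * (norm v)\<^sup>2)"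
      unfolding abs_mult
      by (intro mult_left_mono order_trans[OF M(2)[OF v]] mult_right_mono) auto
    moreover have "\<bar>L v * (g (s + v) - g s)\<bar> \<le> (BL * norm v) * ((BM + \<bar>D\<bar>) * norm v)"
      unfolding abs_mult using BL(1)
      by (intro mult_mono BL(2) G(2)[OF v]) auto
    moreover have "f (s + v) * g (s + v) - f s * g s - (f s * M v + g s * L v)
        = (f (s + v) - f s - L v) * g (s + v) + f s * (g (s + v) - g s - M v)
          + L v * (g (s + v) - g s)"
      by (simp add: algebra_simps)
    ultimately have "\<bar>f (s + v) * g (s + v) - f s * g s - (f s * M v + g s * L v)\<bar>
        \<le> (\<bar>C\<bar> * (norm v)\<^sup>2) * G + \<bar>f s\<bar> * (\<bar>D\<bar> * (norm v)\<^sup>2)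
           + (BL * norm v) * ((BM + \<bar>D\<bar>) * norm v)"
      by linarith
    also have "\<dots> = (\<bar>C\<bar> * G + \<bar>f s\<bar> * \<bar>D\<bar> + BL * (BM + \<bar>D\<bar>)) * (norm v)\<^sup>2"
      by (simp add: algebra_simps power2_eq_square)
    finally show "\<bar>f (s + v) * g (s + v) - f s * g s - (f s * M v + g s * L v)\<bar>
        \<le> (\<bar>C\<bar> * G + \<bar>f s\<bar> * \<bar>D\<bar> + BL * (BM + \<bar>D\<bar>)) * (norm v)\<^sup>2" .
  qed
qed

lemma expands_at_monomial: "expands_at (monomial_fun a) s"
proof -
  have power: "expands_at (\<lambda>x. (x $ i) ^ k) s" for i :: 'a and k
    by (induction k) (simp_all add: expands_at_const expands_at_mult expands_at_coordinate)
  have "expands_at (\<lambda>x. \<Prod>i\<in>I. (x $ i) ^ a i) s" if "finite I" for I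
    using that by induction (simp_all add: expands_at_const expands_at_mult power)
  then show ?thesis by (simp add: monomial_fun_def[abs_def])
qed

lemma expands_at_form: "f \<in> forms m \<Longrightarrow> expands_at f s"
  unfolding forms_def
proof (induction rule: fun_vs.span_induct_alt)
  case base
  then show ?case using expands_at_const[of 0] by (simp add: zero_fun_def)
next
  case (step c g h)
  then have "expands_at (\<lambda>x. c * g x + h x) s"
    by (auto intro!: expands_at_add expands_at_mult expands_at_const expands_at_monomial)
  then show ?case by (simp add: plus_fun_def fun_scale_def)
qed

lemma expands_at_imp_remainder:
  assumes "expands_at f s"
  shows "f differentiable (at s)"
    and "\<exists>C. \<forall>v. norm v \<le> 1 \<longrightarrow> \<bar>f (s + v) - f s - frechet_derivative f (at s) v\<bar> \<le> C * (norm v)\<^sup>2"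
proof -
  obtain L C where L: "linear L"
      "\<And>v. norm v \<le> 1 \<Longrightarrow> \<bar>f (s + v) - f s - L v\<bar> \<le> C * (norm v)\<^sup>2"
    using assms unfolding expands_at_def by blast
  have "(f has_derivative L) (at s)"
    unfolding has_derivative_at
  proof
    show "bounded_linear L" using L(1) by (simp add: linear_conv_bounded_linear)
    have "((\<lambda>v::'a. \<bar>C\<bar> * norm v) \<longlongrightarrow> \<bar>C\<bar> * norm (0::'a)) (at 0)"
      by (intro tendsto_intros)
    then have lim: "((\<lambda>v::'a. \<bar>C\<bar> * norm v) \<longlongrightarrow> 0) (at 0)" by simp
    show "(\<lambda>v. norm (f (s + v) - f s - L v) / norm v) \<midarrow>0\<rightarrow> 0"
    proof (rule Lim_null_comparison[OF _ lim])
      have "eventually (\<lambda>v::'a. norm v < 1 \<and> v \<noteq> 0) (at 0)"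
        unfolding eventually_at by (intro exI[of _ 1]) auto
      then show "\<forall>\<^sub>F v in at 0. norm (norm (f (s + v) - f s - L v) / norm v) \<le> \<bar>C\<bar> * norm v"
      proof eventually_elim
        case (elim v)
        have "\<bar>f (s + v) - f s - L v\<bar> \<le> \<bar>C\<bar> * (norm v)\<^sup>2"
          using elim by (intro order_trans[OF L(2)] mult_right_mono) auto
        then show ?case
          using elim by (simp add: divide_le_eq power2_eq_square mult.assoc)
      qed
    qed
  qed
  then show "f differentiable (at s)" 
    and "\<exists>C. \<forall>v. norm v \<le> 1 \<longrightarrow> \<bar>f (s + v) - f s - frechet_derivative f (at s) v\<bar> \<le> C * (norm v)\<^sup>2"
    using L(2) by (auto simp: differentiable_def simp flip: frechet_derivative_at)
qed

lemma forms_differentiable: "f \<in> forms m \<Longrightarrow> f differentiable (at s)"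
  by (rule expands_at_imp_remainder[OF expands_at_form])

lemma forms_remainder:
  assumes "f \<in> forms m"
  obtains C where "C > 0"
    "\<And>v. norm v \<le> 1 \<Longrightarrow> \<bar>f (s + v) - f s - grad f s v\<bar> \<le> C * (norm v)\<^sup>2"
proof -
  obtain C where C: "\<And>v. norm v \<le> 1 \<Longrightarrow> \<bar>f (s + v) - f s - grad f s v\<bar> \<le> C * (norm v)\<^sup>2"
    using expands_at_imp_remainder(2)[OF expands_at_form[OF assms]] by blast
  have "\<bar>f (s + v) - f s - grad f s v\<bar> \<le> (\<bar>C\<bar> + 1) * (norm v)\<^sup>2" if "norm v \<le> 1" for v
    by (rule order_trans[OF C[OF that]], rule mult_right_mono) auto
  then show ?thesis by (rule that[of "\<bar>C\<bar> + 1", rotated]) auto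
qed

lemma grad_linear: "f \<in> forms m \<Longrightarrow> linear (grad f s)"
  by (rule linear_frechet_derivative[OF forms_differentiable])

lemma grad_add:
  assumes "f \<in> forms m" "g \<in> forms m"
  shows "grad (f + g) s v = grad f s v + grad g s v"
proof -
  have "((\<lambda>x. f x + g x) has_derivative (\<lambda>v. grad f s v + grad g s v)) (at s)"
    using assms forms_differentiable frechet_derivative_works by (intro has_derivative_add) blast+
  then show ?thesis
    unfolding plus_fun_def by (simp flip: frechet_derivative_at)
qed

lemma grad_scale:
  assumes "f \<in> forms m"
  shows "grad (fun_scale c f) s v = c * grad f s v"
proof -
  have "((\<lambda>x. c * f x) has_derivative (\<lambda>v. c * grad f s v)) (at s)"
    using assms forms_differentiable frechet_derivative_works
    by (intro has_derivative_mult_right) blast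
  then show ?thesis
    unfolding fun_scale_def by (simp flip: frechet_derivative_at)
qed

lemma grad_along_line:
  assumes "f \<in> forms m"
  shows "((\<lambda>t. f (s + t *\<^sub>R v)) has_real_derivative grad f s v) (at 0)"
proof -
  have "(f has_derivative grad f s) (at (s + 0 *\<^sub>R v))"
    using forms_differentiable[OF assms] frechet_derivative_works by auto
  then have "((\<lambda>t. f (s + t *\<^sub>R v)) has_derivative (\<lambda>t. grad f s (t *\<^sub>R v))) (at 0)"
    by (rule has_derivative_compose[rotated]) (auto intro!: derivative_eq_intros)
  then show ?thesis
    by (simp add: has_field_derivative_def linear_scale[OF grad_linear[OF assms]] mult.commute[of _ "grad f s v"])
qed

text \<open>
  Both sides are the derivative at \<open>t = 0\<close> of \<open>t \<mapsto> f (s + t s) = (1 + t)^m f s\<close>. Consequently a form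
  vanishing at \<open>s\<close> has zero derivative in the direction \<open>s\<close>, and a form of positive degree with zero
  gradient at \<open>s\<close> vanishes at \<open>s\<close>.
\<close>

lemma euler_identity:
  assumes "f \<in> forms m"
  shows "grad f s s = m * f s"
proof -
  have "f (s + t *\<^sub>R s) = (1 + t) ^ m * f s" for t
    using forms_homogeneous[OF assms, of "1 + t" s] by (simp add: scaleR_add_left)
  then have "((\<lambda>t. (1 + t) ^ m * f s) has_real_derivative grad f s s) (at 0)"
    using grad_along_line[OF assms, of s s] by simp
  moreover have "((\<lambda>t. (1 + t) ^ m * f s) has_real_derivative m * f s) (at 0)"
    by (auto intro!: derivative_eq_intros)
  ultimately show ?thesis by (rule DERIV_unique)
qed

lemma vanishes_order2_iff:
  assumes "f \<in> forms m"
  shows "vanishes_order2 f s \<longleftrightarrow> (\<forall>v. grad f s v = 0)"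
proof
  assume v2: "vanishes_order2 f s"
  have "grad f s (axis i 1) = 0" for i
    using v2 grad_along_line[OF assms] DERIV_unique unfolding vanishes_order2_def by blast
  then have "grad f s b = 0" if "b \<in> Basis" for b
    using that by (auto simp: Basis_vec_def)
  then show "\<forall>v. grad f s v = 0"
    using linear_eq_stdbasis[OF grad_linear[OF assms] linear_zero] by (auto simp: fun_eq_iff)
next
  assume "\<forall>v. grad f s v = 0"
  then show "vanishes_order2 f s"
    unfolding vanishes_order2_def using grad_along_line[OF assms] by metis
qed

lemma forms_continuous: "f \<in> forms m \<Longrightarrow> isCont f s"
  using forms_differentiable differentiable_imp_continuous_within by blast

section \<open>Sums of squares that dominate singular forms\<close>

text \<open>
  A finite subcover leaves finitely many local factors \<open>e\<close>; as \<open>g\<close> is nonnegative, their minimum works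
  everywhere.
\<close>

lemma compact_uniform_multiple:
  fixes g h :: "'a::topological_space \<Rightarrow> real"
  assumes "compact K" and g: "\<And>x. g x \<ge> 0"
    and loc: "\<And>x. x \<in> K \<Longrightarrow> \<exists>e>0. \<forall>\<^sub>F y in nhds x. e * g y \<le> h y"
  shows "\<exists>e>0. \<forall>y\<in>K. e * g y \<le> h y"
proof -
  have "\<exists>e U. x \<in> K \<longrightarrow> e > 0 \<and> open U \<and> x \<in> U \<and> (\<forall>y\<in>U. e * g y \<le> h y)" for x
    using loc[of x] unfolding eventually_nhds by blast
  then obtain e U where eU: "\<And>x. x \<in> K \<Longrightarrow> e x > 0 \<and> open (U x) \<and> x \<in> U x \<and> (\<forall>y\<in>U x. e x * g y \<le> h y)"
    by metis
  obtain D where D: "D \<subseteq> K" "finite D" "K \<subseteq> (\<Union>x\<in>D. U x)"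
    using compactE_image[OF assms(1), of K U] eU by blast
  define m where "m = Min (insert 1 (e ` D))"
  have "m > 0" using D eU by (auto simp: m_def)
  moreover have "m * g y \<le> h y" if "y \<in> K" for y
  proof -
    obtain x where x: "x \<in> D" "y \<in> U x" using \<open>y \<in> K\<close> D(3) by blast
    have "m \<le> e x" using x D by (simp add: m_def)
    then have "m * g y \<le> e x * g y" using g by (rule mult_right_mono)
    then show ?thesis using eU x D by fastforce
  qed
  ultimately show ?thesis by blast
qed

text \<open>
  To leading order \<open>b (s + v)\<close> is \<open>grad b s v\<close>, so the sum of squares is approximated by the quadratic
  form \<open>\<Sum> (grad b s v)\<^sup>2\<close>. By \<open>nondeg\<close> this is positive definite on the hyperplane orthogonal to \<open>s\<close>,
  hence at least \<open>m |v|\<^sup>2\<close> there, while the error is of order \<open>|v|^4\<close>. The direction \<open>s\<close> itself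
  must be excluded, because the forms vanish along the whole line through \<open>s\<close>.
\<close>

lemma sum_squares_ge_quadratic:
  fixes s :: "real ^ 'n::finite"
  assumes "finite B" and B: "B \<subseteq> forms d" and zero: "\<And>b. b \<in> B \<Longrightarrow> b s = 0"
    and nondeg: "\<And>v. v \<bullet> s = 0 \<Longrightarrow> v \<noteq> 0 \<Longrightarrow> \<exists>b\<in>B. grad b s v \<noteq> 0"
  shows "\<exists>c>0. \<exists>\<delta>>0. \<forall>v. v \<bullet> s = 0 \<longrightarrow> norm v \<le> \<delta> \<longrightarrow> c * (norm v)\<^sup>2 \<le> (\<Sum>b\<in>B. (b (s + v))\<^sup>2)"
proof -
  define G where "G v = (\<Sum>b\<in>B. (grad b s v)\<^sup>2)" for v
  have lin: "linear (grad b s)" if "b \<in> B" for b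
    using grad_linear that B by blast
  obtain m where m: "m > 0" "\<And>v. v \<bullet> s = 0 \<Longrightarrow> m * (norm v)\<^sup>2 \<le> G v"
  proof -
    define K where "K = sphere 0 1 \<inter> {v. v \<bullet> s = 0}"
    have "compact K"
      unfolding K_def by (intro compact_Int_closed compact_sphere closed_Collect_eq continuous_intros)
    have "\<exists>m>0. \<forall>v\<in>K. m * 1 \<le> G v"
    proof (rule compact_uniform_multiple[OF \<open>compact K\<close>])
      fix x assume x: "x \<in> K"
      have "isCont (grad b s) x" if "b \<in> B" for b
        using lin[OF that] linear_continuous_at linear_conv_bounded_linear by blast
      then have "isCont G x"
        unfolding G_def by (intro continuous_intros)
      moreover obtain b where "b \<in> B" "grad b s x \<noteq> 0"
        using nondeg[of x] x unfolding K_def by fastforce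
      then have pos: "G x > 0"
        unfolding G_def using \<open>finite B\<close> by (intro sum_pos2[of _ b]) auto
      ultimately have "\<forall>\<^sub>F y in nhds x. G x / 2 < G y"
        by (intro order_tendstoD(1)[of G "G x"]) (auto simp: isCont_def tendsto_at_iff_tendsto_nhds)
      then show "\<exists>e>0. \<forall>\<^sub>F y in nhds x. e * 1 \<le> G y"
        using pos by (intro exI[of _ "G x / 2"]) (auto elim: eventually_mono)
    qed simp
    then obtain m where m: "m > 0" "\<And>v. v \<in> K \<Longrightarrow> m \<le> G v" by auto
    have "m * (norm v)\<^sup>2 \<le> G v" if "v \<bullet> s = 0" for v
    proof (cases "v = 0")
      case True
      then show ?thesis by (simp add: G_def sum_nonneg)
    next
      case False
      have "(1 / norm v) *\<^sub>R v \<in> K" using False that by (simp add: K_def)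
      then have "m \<le> G ((1 / norm v) *\<^sub>R v)" by (rule m(2))
      also have "\<dots> = G v / (norm v)\<^sup>2"
        unfolding G_def sum_divide_distrib
        by (intro sum.cong refl) (simp add: linear_scale[OF lin] power_mult_distrib power_divide)
      finally show ?thesis using False by (simp add: le_divide_eq)
    qed
    then show ?thesis using that m(1) by blast
  qed
  have "\<exists>C>0. \<forall>v. norm v \<le> 1 \<longrightarrow> \<bar>b (s + v) - b s - grad b s v\<bar> \<le> C * (norm v)\<^sup>2" if "b \<in> B" for b
    using forms_remainder[of b d s] that B by blast
  then obtain C where C: "\<And>b v. b \<in> B \<Longrightarrow> norm v \<le> 1 \<Longrightarrow>
      \<bar>b (s + v) - b s - grad b s v\<bar> \<le> C b * (norm v)\<^sup>2"
    by metis
  define A where "A = (\<Sum>b\<in>B. (C b)\<^sup>2)"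
  have "A \<ge> 0" by (simp add: A_def sum_nonneg)
  \<comment> \<open>Inside this radius the error \<open>2 A |v|^4\<close> uses up at most half of \<open>m |v|\<^sup>2\<close>.\<close>
  define \<delta> where "\<delta> = min 1 (sqrt (m / (4 * (A + 1))))"
  have \<delta>: "\<delta> > 0" using m(1) \<open>A \<ge> 0\<close> by (simp add: \<delta>_def)
  have "m / 4 * (norm v)\<^sup>2 \<le> (\<Sum>b\<in>B. (b (s + v))\<^sup>2)" if v: "v \<bullet> s = 0" "norm v \<le> \<delta>" for v
  proof -
    have "(grad b s v)\<^sup>2 \<le> 2 * (b (s + v))\<^sup>2 + 2 * ((C b)\<^sup>2 * (norm v) ^ 4)" if b: "b \<in> B" for b
    proof -
      define r where "r = b (s + v) - grad b s v"
      have "\<bar>r\<bar> \<le> C b * (norm v)\<^sup>2"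
        using C[OF b, of v] zero[OF b] v by (simp add: r_def \<delta>_def)
      then have "r\<^sup>2 \<le> (C b * (norm v)\<^sup>2)\<^sup>2" by (rule abs_le_square_iff[THEN iffD1, OF order_trans]) simp
      then have "r\<^sup>2 \<le> (C b)\<^sup>2 * (norm v) ^ 4" by (simp add: power_mult_distrib flip: power_mult)
      moreover have "(grad b s v)\<^sup>2 \<le> 2 * (b (s + v))\<^sup>2 + 2 * r\<^sup>2"
      proof -
        \<comment> \<open>That is, \<open>(x - r)\<^sup>2 \<le> 2 x\<^sup>2 + 2 r\<^sup>2\<close> for \<open>x = b (s + v)\<close>.\<close>
        have "0 \<le> (b (s + v) + r)\<^sup>2" by simp
        then show ?thesis by (simp add: r_def power2_eq_square algebra_simps)
      qed
      ultimately show ?thesis by linarith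
    qed
    then have "G v \<le> 2 * (\<Sum>b\<in>B. (b (s + v))\<^sup>2) + 2 * (A * (norm v) ^ 4)"
      unfolding G_def A_def sum_distrib_left sum_distrib_right sum.distrib[symmetric]
      by (intro sum_mono)
    moreover have "A * (norm v) ^ 4 \<le> m / 4 * (norm v)\<^sup>2"
    proof -
      have "norm v \<le> sqrt (m / (4 * (A + 1)))" using v by (simp add: \<delta>_def)
      then have "(norm v)\<^sup>2 \<le> m / (4 * (A + 1))"
        by (intro sqrt_ge_absD) simp
      then have "(A + 1) * (norm v)\<^sup>2 \<le> m / 4"
        using \<open>A \<ge> 0\<close> by (simp add: field_simps)
      then have "(A + 1) * (norm v)\<^sup>2 * (norm v)\<^sup>2 \<le> m / 4 * (norm v)\<^sup>2"
        by (rule mult_right_mono) simp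
      moreover have "(A + 1) * (norm v)\<^sup>2 * (norm v)\<^sup>2 = A * (norm v) ^ 4 + (norm v) ^ 4"
        by (simp add: algebra_simps power4_eq_xxxx power2_eq_square)
      ultimately show ?thesis by (smt (verit) zero_le_power norm_ge_zero)
    qed
    ultimately show ?thesis using m(2)[OF v(1)] by linarith
  qed
  then show ?thesis using m(1) \<delta> by (intro exI[of _ "m / 4"]) auto
qed

text \<open>
  A point \<open>y\<close> near \<open>c s\<close> is a multiple \<open>a (s + u)\<close> with \<open>u\<close> small and orthogonal to \<open>s\<close>. By homogeneity
  the claim at \<open>y\<close> is the claim at \<open>s + u\<close>, where \<open>w\<close> is at most a multiple of \<open>|u|\<^sup>2\<close> and the sum of
  squares is at least one.
\<close>

lemma sum_squares_dominates_near_zero: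
  fixes s :: "real ^ 'n::finite"
  assumes "finite B" and B: "B \<subseteq> forms d" and zero: "\<And>b. b \<in> B \<Longrightarrow> b s = 0"
    and nondeg: "\<And>v. v \<bullet> s = 0 \<Longrightarrow> v \<noteq> 0 \<Longrightarrow> \<exists>b\<in>B. grad b s v \<noteq> 0"
    and w: "w \<in> forms (2 * d)" "w s = 0" "\<And>v. grad w s v = 0"
    and "s \<noteq> 0" "c \<noteq> 0"
  shows "\<exists>e>0. \<forall>\<^sub>F y in nhds (c *\<^sub>R s). e * \<bar>w y\<bar> \<le> (\<Sum>b\<in>B. (b y)\<^sup>2)"
proof -
  have "\<exists>m>0. \<exists>\<delta>>0. \<forall>v. v \<bullet> s = 0 \<longrightarrow> norm v \<le> \<delta> \<longrightarrow> m * (norm v)\<^sup>2 \<le> (\<Sum>b\<in>B. (b (s + v))\<^sup>2)"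
    by (rule sum_squares_ge_quadratic[OF \<open>finite B\<close> B]) (use zero nondeg in auto)
  then obtain m \<delta> where m: "m > 0" "\<delta> > 0"
      "\<And>v. v \<bullet> s = 0 \<Longrightarrow> norm v \<le> \<delta> \<Longrightarrow> m * (norm v)\<^sup>2 \<le> (\<Sum>b\<in>B. (b (s + v))\<^sup>2)"
    by blast
  obtain C where C: "C > 0"
      "\<And>v. norm v \<le> 1 \<Longrightarrow> \<bar>w (s + v) - w s - grad w s v\<bar> \<le> C * (norm v)\<^sup>2"
    using forms_remainder[OF w(1)] by blast
  \<comment> \<open>The affine chart of projective space around \<open>s\<close>: rescale \<open>y\<close> to have the same \<open>s\<close>-component as \<open>s\<close>.\<close>
  define a where "a y = (y \<bullet> s) / (s \<bullet> s)" for y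
  define u where "u y = (1 / a y) *\<^sub>R y - s" for y
  have ac: "a (c *\<^sub>R s) = c" and uc: "u (c *\<^sub>R s) = 0"
    using \<open>s \<noteq> 0\<close> \<open>c \<noteq> 0\<close> by (simp_all add: a_def u_def)
  have "isCont a (c *\<^sub>R s)"
    unfolding a_def using \<open>s \<noteq> 0\<close> by (intro continuous_intros) auto
  then have a_lim: "(a \<longlongrightarrow> c) (nhds (c *\<^sub>R s))"
    unfolding isCont_def using tendsto_at_iff_tendsto_nhds ac by metis
  have "isCont u (c *\<^sub>R s)"
    unfolding u_def using \<open>isCont a _\<close> ac \<open>c \<noteq> 0\<close> by (intro continuous_intros) auto
  then have u_lim: "(u \<longlongrightarrow> 0) (nhds (c *\<^sub>R s))"
    unfolding isCont_def using tendsto_at_iff_tendsto_nhds uc by metis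
  have "\<forall>\<^sub>F y in nhds (c *\<^sub>R s). a y \<noteq> 0"
    using a_lim \<open>c \<noteq> 0\<close> by (rule tendsto_imp_eventually_ne)
  moreover have "\<forall>\<^sub>F y in nhds (c *\<^sub>R s). norm (u y) < min 1 \<delta>"
    using tendstoD[OF u_lim, of "min 1 \<delta>"] m(2) by simp
  ultimately have "\<forall>\<^sub>F y in nhds (c *\<^sub>R s). m / C * \<bar>w y\<bar> \<le> (\<Sum>b\<in>B. (b y)\<^sup>2)"
  proof eventually_elim
    case (elim y)
    have y: "y = a y *\<^sub>R (s + u y)" using elim(1) by (simp add: u_def)
    have perp: "u y \<bullet> s = 0"
      using elim(1) \<open>s \<noteq> 0\<close> by (simp add: u_def a_def inner_diff_left)
    have "\<bar>w (s + u y)\<bar> \<le> C * (norm (u y))\<^sup>2"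
      using C(2)[of "u y"] w elim(2) by simp
    then have "m / C * \<bar>w (s + u y)\<bar> \<le> m * (norm (u y))\<^sup>2"
      using C(1) m(1) by (simp add: field_simps)
    also have "\<dots> \<le> (\<Sum>b\<in>B. (b (s + u y))\<^sup>2)"
      using m(3)[OF perp] elim(2) by simp
    finally have le: "m / C * \<bar>w (s + u y)\<bar> \<le> (\<Sum>b\<in>B. (b (s + u y))\<^sup>2)" .
    have wy: "\<bar>w y\<bar> = (a y) ^ (2 * d) * \<bar>w (s + u y)\<bar>"
      by (subst y, subst forms_homogeneous[OF w(1)]) (simp add: abs_mult power_mult)
    have "(b y)\<^sup>2 = (a y) ^ (2 * d) * (b (s + u y))\<^sup>2" if "b \<in> B" for b
      by (subst y, subst forms_homogeneous[of b d])
        (use that B in \<open>auto simp: power_mult_distrib mult.commute[of 2] power_mult\<close>)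
    then have sq: "(\<Sum>b\<in>B. (b y)\<^sup>2) = (a y) ^ (2 * d) * (\<Sum>b\<in>B. (b (s + u y))\<^sup>2)"
      by (simp add: sum_distrib_left)
    have "(a y) ^ (2 * d) \<ge> 0" by (simp add: power_mult)
    then have "(a y) ^ (2 * d) * (m / C * \<bar>w (s + u y)\<bar>) \<le> (a y) ^ (2 * d) * (\<Sum>b\<in>B. (b (s + u y))\<^sup>2)"
      using le by (rule mult_left_mono[rotated])
    then show ?case unfolding wy sq by (simp add: mult_ac)
  qed
  then show ?thesis using m(1) C(1) by (intro exI[of _ "m / C"]) simp
qed

text \<open>
  Homogeneity reduces the claim to the unit sphere and compactness to a neighbourhood of each of its
  points. Where the sum of squares is positive, continuity is enough; the remaining points lie on the
  lines through \<open>S\<close>.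
\<close>

lemma sum_squares_dominates:
  fixes S :: "(real ^ 'n::finite) set"
  assumes "d > 0" "finite B" and B: "B \<subseteq> forms d" "B \<subseteq> vanishing_on S"
    and zeros: "\<And>x. x \<noteq> 0 \<Longrightarrow> (\<And>b. b \<in> B \<Longrightarrow> b x = 0) \<Longrightarrow> \<exists>s\<in>S. \<exists>c. x = c *\<^sub>R s"
    and nondeg: "\<And>s v. s \<in> S \<Longrightarrow> v \<bullet> s = 0 \<Longrightarrow> v \<noteq> 0 \<Longrightarrow> \<exists>b\<in>B. grad b s v \<noteq> 0"
    and w: "w \<in> forms (2 * d)" "\<And>s. s \<in> S \<Longrightarrow> w s = 0" "\<And>s v. s \<in> S \<Longrightarrow> grad w s v = 0"
  shows "\<exists>e>0. \<forall>x. e * \<bar>w x\<bar> \<le> (\<Sum>b\<in>B. (b x)\<^sup>2)"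
proof -
  define p where "p x = (\<Sum>b\<in>B. (b x)\<^sup>2)" for x
  have "\<exists>e>0. \<forall>x\<in>sphere 0 1. e * \<bar>w x\<bar> \<le> p x"
  proof (rule compact_uniform_multiple[OF compact_sphere])
    fix x :: "real ^ 'n" assume x: "x \<in> sphere 0 1"
    show "\<exists>e>0. \<forall>\<^sub>F y in nhds x. e * \<bar>w y\<bar> \<le> p y"
    proof (cases "p x = 0")
      case True
      have "b x = 0" if "b \<in> B" for b
        using True that \<open>finite B\<close> by (simp add: p_def sum_nonneg_eq_0_iff)
      moreover have "x \<noteq> 0" using x by auto
      ultimately obtain s c where sc: "s \<in> S" "x = c *\<^sub>R s" using zeros by blast
      have "b s = 0" if "b \<in> B" for b
        using B(2) that sc(1) by (auto simp: vanishing_on_def)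
      then show ?thesis
        unfolding p_def sc(2)
        using assms sc \<open>x \<noteq> 0\<close>
        by (intro sum_squares_dominates_near_zero[of B d s w c]) auto
    next
      case False
      have "p x \<ge> 0" by (simp add: p_def sum_nonneg)
      then have pos: "p x > 0" using False by simp
      define e where "e = p x / (2 * (\<bar>w x\<bar> + 1))"
      have "e > 0" using pos by (simp add: e_def)
      have "isCont p x"
        unfolding p_def using B(1) by (intro continuous_intros forms_continuous) blast
      moreover have "isCont w x" using w(1) by (rule forms_continuous)
      ultimately have "isCont (\<lambda>y. p y - e * \<bar>w y\<bar>) x" by (intro continuous_intros)
      then have "((\<lambda>y. p y - e * \<bar>w y\<bar>) \<longlongrightarrow> p x - e * \<bar>w x\<bar>) (nhds x)"
        unfolding isCont_def by (rule tendsto_at_iff_tendsto_nhds[THEN iffD1])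
      moreover have "p x - e * \<bar>w x\<bar> > 0"
        using pos by (simp add: e_def field_simps add_nonneg_pos)
      ultimately have "\<forall>\<^sub>F y in nhds x. 0 < p y - e * \<bar>w y\<bar>" by (rule order_tendstoD(1))
      then show ?thesis
        using \<open>e > 0\<close> by (intro exI[of _ e]) (auto elim: eventually_mono)
    qed
  qed simp
  then obtain e where e: "e > 0" "\<And>x. x \<in> sphere 0 1 \<Longrightarrow> e * \<bar>w x\<bar> \<le> p x" by blast
  have "e * \<bar>w x\<bar> \<le> p x" for x
  proof (cases "x = 0")
    case True
    have "w 0 = 0"
      using forms_homogeneous[OF w(1), of 0 0] \<open>d > 0\<close> by (simp add: zero_power)
    then show ?thesis using True by (simp add: p_def sum_nonneg)
  next
    case False
    define y where "y = (1 / norm x) *\<^sub>R x"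
    have x: "x = norm x *\<^sub>R y" using False by (simp add: y_def)
    have wx: "\<bar>w x\<bar> = (norm x) ^ (2 * d) * \<bar>w y\<bar>"
      by (subst x, subst forms_homogeneous[OF w(1)]) (simp add: abs_mult)
    have "(b x)\<^sup>2 = (norm x) ^ (2 * d) * (b y)\<^sup>2" if "b \<in> B" for b
      by (subst x, subst forms_homogeneous[of b d])
        (use that B in \<open>auto simp: power_mult_distrib mult.commute[of 2] power_mult\<close>)
    then have px: "p x = (norm x) ^ (2 * d) * p y"
      by (simp add: p_def sum_distrib_left)
    have "e * \<bar>w y\<bar> \<le> p y" using False by (intro e(2)) (simp add: y_def)
    then have "(norm x) ^ (2 * d) * (e * \<bar>w y\<bar>) \<le> (norm x) ^ (2 * d) * p y"
      by (rule mult_left_mono) simp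
    then show ?thesis unfolding wx px by (simp add: mult_ac)
  qed
  then show ?thesis using e(1) unfolding p_def by blast
qed

section \<open>Dimension count for independent sets\<close>

lemma I1_subset_span_monomials: "I1 d S \<subseteq> fun_vs.span (monomials d)"
  by (auto simp: I1_def forms_def)

lemma subspace_I1: "fun_vs.subspace (I1 d S)"
  using subspace_forms[of d]
  unfolding I1_def vanishing_on_def fun_vs.subspace_def by (auto simp: fun_scale_def)

lemma I1_finite_basis:
  obtains B where "finite B" "B \<subseteq> I1 d S" "I1 d S \<subseteq> fun_vs.span B" "card B = fun_vs.dim (I1 d S)"
proof -
  obtain B where B: "B \<subseteq> I1 d S" "fun_vs.independent B" "I1 d S \<subseteq> fun_vs.span B"
      "card B = fun_vs.dim (I1 d S)"
    by (rule fun_vs.basis_exists)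
  have "B \<subseteq> fun_vs.span (monomials d)"
    using B(1) I1_subset_span_monomials by (rule subset_trans)
  then have "finite B"
    using fun_vs.independent_span_bound[OF finite_monomials B(2)] by simp
  then show ?thesis using that B by simp
qed

lemma dim_forms_le_dim_I1_add_card:
  fixes S :: "(real ^ 'n::finite) set"
  assumes "finite S"
  shows "fun_vs.dim (forms d :: (real ^ 'n \<Rightarrow> real) set) \<le> fun_vs.dim (I1 d S) + card S"
proof -
  have "fun_vs.dim (forms d :: (real ^ 'n \<Rightarrow> real) set)
      \<le> fun_vs.dim {p \<in> forms d. \<forall>s\<in>S. p s = 0} + card S"
    using assms
    by (intro fun_vs.dim_le_dim_kernel_add_card[OF subspace_forms _ finite_monomials, where \<phi> = "\<lambda>s p. p s"])
      (auto simp: forms_def fun_scale_def)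
  moreover have "{p \<in> forms d. \<forall>s\<in>S. p s = 0} = I1 d S"
    by (auto simp: I1_def vanishing_on_def)
  ultimately show ?thesis by simp
qed

text \<open>
  Complete \<open>T\<close> to a basis of \<open>\<real>^n\<close>. The gradient at \<open>s\<close> of a form in \<open>I1 d S\<close> is already zero on \<open>T\<close>, so
  only the remaining \<open>n - card T\<close> linear conditions are needed to cut out the forms that are singular
  at \<open>s\<close> and vanish on the rest of \<open>S\<close>, whose codimension is prescribed by independence. Both
  consequences of condition (2) come from this count: \<open>T = {s}\<close> gives the codimension of \<open>I1 d S\<close>, and
  \<open>T = {s, v}\<close> shows that no further direction \<open>v\<close> can be annihilated by all gradients.
\<close>

lemma dim_I1_le:
  fixes S :: "(real ^ 'n::finite) set"
  assumes "d > 0" "d_independent d S" "s \<in> S" "independent T"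
    and T: "\<And>q t. q \<in> I1 d S \<Longrightarrow> t \<in> T \<Longrightarrow> grad q s t = 0"
  shows "fun_vs.dim (I1 d S) + card S + card T \<le> fun_vs.dim (forms d :: (real ^ 'n \<Rightarrow> real) set) + 1"
proof -
  let ?K = "{p \<in> forms d. vanishes_order2 p s \<and> p \<in> vanishing_on (S - {s})}"
  obtain E where E: "T \<subseteq> E" "independent E" "span E = UNIV"
  proof (rule that)
    show "T \<subseteq> extend_basis T" "independent (extend_basis T)" "span (extend_basis T) = UNIV"
      using assms(4) by (simp_all add: extend_basis_superset independent_extend_basis)
  qed
  have finE: "finite E" using E(2) by (rule independent_imp_finite)
  have cardE: "card E = CARD('n)"
    using dim_span_eq_card_independent[OF E(2)] unfolding E(3) by simp
  have "fun_vs.dim (I1 d S) \<le> fun_vs.dim {q \<in> I1 d S. \<forall>u\<in>E - T. grad q s u = 0} + card (E - T)"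
    using finE
    by (intro fun_vs.dim_le_dim_kernel_add_card[OF subspace_I1 I1_subset_span_monomials finite_monomials])
      (auto simp: I1_def grad_add[of _ d] grad_scale[of _ d])
  also have "{q \<in> I1 d S. \<forall>u\<in>E - T. grad q s u = 0} \<subseteq> ?K"
  proof
    fix q assume q: "q \<in> {q \<in> I1 d S. \<forall>u\<in>E - T. grad q s u = 0}"
    then have form: "q \<in> forms d" by (simp add: I1_def)
    have "grad q s u = 0" if "u \<in> E" for u using q T that by blast
    then have "grad q s v = 0" for v
      using linear_eq_on_span[OF grad_linear[OF form] linear_zero, of E s v] E(3) by auto
    then show "q \<in> ?K"
      using q form by (auto simp: vanishes_order2_iff[OF form] I1_def vanishing_on_def)
  qed
  then have "fun_vs.dim {q \<in> I1 d S. \<forall>u\<in>E - T. grad q s u = 0} \<le> fun_vs.dim ?K"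
    by (intro fun_vs.dim_mono_finite_span[of _ _ "monomials d"] finite_monomials)
      (auto simp: forms_def intro: fun_vs.span_base)
  finally have "fun_vs.dim (I1 d S) \<le> fun_vs.dim ?K + card (E - T)" by simp
  moreover have "fun_vs.dim ?K + (card S + CARD('n) - 1) = fun_vs.dim (forms d :: (real ^ 'n \<Rightarrow> real) set)"
    using assms(2,3) by (simp add: d_independent_def)
  moreover have "card (E - T) + card T = CARD('n)"
    using card_Diff_subset[OF finite_subset[OF E(1) finE] E(1)] card_mono[OF finE E(1)] cardE
    by linarith
  moreover have "CARD('n) > 0" by simp
  ultimately show ?thesis by linarith
qed

lemma grad_radial_eq_0:
  assumes "q \<in> I1 d S" "s \<in> S"
  shows "grad q s s = 0"
  using assms euler_identity[of q d s] by (auto simp: I1_def vanishing_on_def)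

lemma dim_I1:
  fixes S :: "(real ^ 'n::finite) set"
  assumes "d > 0" "d_independent d S"
  shows "fun_vs.dim (I1 d S) + card S = fun_vs.dim (forms d :: (real ^ 'n \<Rightarrow> real) set)"
proof (rule antisym)
  have S: "finite S" "0 \<notin> S"
    using assms(2) by (auto simp: d_independent_def projective_points_def)
  show "fun_vs.dim (forms d :: (real ^ 'n \<Rightarrow> real) set) \<le> fun_vs.dim (I1 d S) + card S"
    using S(1) by (rule dim_forms_le_dim_I1_add_card)
  show "fun_vs.dim (I1 d S) + card S \<le> fun_vs.dim (forms d :: (real ^ 'n \<Rightarrow> real) set)"
  proof (cases "S = {}")
    case True
    then show ?thesis by (simp add: I1_def vanishing_on_def)
  next
    case False
    then obtain s where s: "s \<in> S" by blast
    then have "s \<noteq> 0" using S(2) by blast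
    then have "independent {s}" by simp
    then show ?thesis
      using dim_I1_le[OF assms s, of "{s}"] grad_radial_eq_0[OF _ s] by simp
  qed
qed

text \<open>
  Otherwise all gradients at \<open>s\<close> would vanish on the plane spanned by \<open>s\<close> and \<open>v\<close>, and \<open>I1 d S\<close> would have
  codimension greater than \<open>card S\<close>.
\<close>

lemma ex_transversal_gradient:
  assumes "d > 0" "d_independent d S" "s \<in> S" "v \<bullet> s = 0" "v \<noteq> 0"
  shows "\<exists>q\<in>I1 d S. grad q s v \<noteq> 0"
proof (rule ccontr)
  assume "\<not> ?thesis"
  then have v: "grad q s v = 0" if "q \<in> I1 d S" for q using that by blast
  have "s \<noteq> 0"
    using assms(2,3) by (auto simp: d_independent_def projective_points_def)
  have "s \<noteq> v" using assms(4,5) by auto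
  have "independent {s, v}"
    using assms(4,5) \<open>s \<noteq> 0\<close>
    by (intro pairwise_orthogonal_independent) (auto simp: pairwise_def orthogonal_def inner_commute)
  then have "fun_vs.dim (I1 d S) + card S + card {s, v} \<le> fun_vs.dim (forms d :: (real ^ 'a \<Rightarrow> real) set) + 1"
    using v grad_radial_eq_0 assms(3) by (intro dim_I1_le[OF assms(1-3)]) auto
  then show False
    using dim_I1[OF assms(1,2)] \<open>s \<noteq> v\<close> by simp
qed

section \<open>The two cones\<close>

definition singular_forms :: "nat \<Rightarrow> (real ^ 'n::finite) set \<Rightarrow> (real ^ 'n \<Rightarrow> real) set" where
  "singular_forms m S = {w \<in> forms m. \<forall>s\<in>S. \<forall>v. grad w s v = 0}"

text \<open>
  Being singular at a point amounts to \<open>n\<close> linear conditions, one for each partial derivative.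
\<close>

lemma dim_singular_forms_ge:
  fixes S :: "(real ^ 'n::finite) set"
  assumes "finite S"
  shows "fun_vs.dim (forms m :: (real ^ 'n \<Rightarrow> real) set)
    \<le> fun_vs.dim (singular_forms m S) + card S * CARD('n)"
proof -
  have "fun_vs.dim (forms m :: (real ^ 'n \<Rightarrow> real) set)
      \<le> fun_vs.dim {w \<in> forms m. \<forall>j\<in>S \<times> Basis. grad w (fst j) (snd j) = 0}
        + card (S \<times> (Basis :: (real ^ 'n) set))"
    using assms
    by (intro fun_vs.dim_le_dim_kernel_add_card[OF subspace_forms _ finite_monomials])
      (auto simp: forms_def[symmetric] grad_add[of _ m] grad_scale[of _ m])
  moreover have "{w \<in> forms m. \<forall>j\<in>S \<times> Basis. grad w (fst j) (snd j) = 0} = singular_forms m S"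
  proof -
    have "grad w s v = 0" if "w \<in> forms m" "\<forall>b\<in>Basis. grad w s b = 0" for w s and v :: "real ^ 'n"
      using linear_eq_stdbasis[OF grad_linear[OF that(1)] linear_zero, of s] that(2)
      by (auto simp: fun_eq_iff)
    then show ?thesis unfolding singular_forms_def by auto
  qed
  ultimately show ?thesis by (simp add: card_cartesian_product)
qed

text \<open>
  Let \<open>p\<close> be the sum of the squares of a basis of \<open>I1 d S\<close>. It vanishes, projectively, exactly on \<open>S\<close>
  by condition (1), and its Hessian at each point of \<open>S\<close> is as nondegenerate as homogeneity permits by
  condition (2). Hence \<open>p + e w\<close> is still nonnegative for small \<open>e > 0\<close>, and \<open>w\<close> is a multiple of the
  difference of \<open>p + e w\<close> and \<open>p\<close>, both of which lie in the cone.
\<close>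

lemma singular_forms_subset_span_Pos_at:
  fixes S :: "(real ^ 'n::finite) set"
  assumes "d > 0" "d_independent d S"
  shows "singular_forms (2 * d) S \<subseteq> fun_vs.span (Pos_at d S)"
proof
  fix w assume "w \<in> singular_forms (2 * d) S"
  then have w: "w \<in> forms (2 * d)" and grad_w: "\<And>s v. s \<in> S \<Longrightarrow> grad w s v = 0"
    by (simp_all add: singular_forms_def)
  have w0: "w s = 0" if "s \<in> S" for s
    using euler_identity[OF w, of s] grad_w[OF that, of s] \<open>d > 0\<close> by simp
  have zeros: "common_zeros (I1 d S) = proj_point ` S"
    using assms(2) by (simp add: d_independent_def)
  obtain B where finB: "finite B" and B: "B \<subseteq> I1 d S" "I1 d S \<subseteq> fun_vs.span B"
    by (rule I1_finite_basis)
  have Bf: "B \<subseteq> forms d" "B \<subseteq> vanishing_on S" using B(1) by (auto simp: I1_def)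
  define p where "p = (\<lambda>x. \<Sum>b\<in>B. (b x)\<^sup>2)"
  have "\<exists>e>0. \<forall>x. e * \<bar>w x\<bar> \<le> (\<Sum>b\<in>B. (b x)\<^sup>2)"
  proof (rule sum_squares_dominates[OF \<open>d > 0\<close> finB Bf _ _ w w0 grad_w])
    fix x assume x: "x \<noteq> 0" "\<And>b. b \<in> B \<Longrightarrow> b x = 0"
    have "q x = 0" if "q \<in> I1 d S" for q
      using subsetD[OF B(2) that]
      by (induction rule: fun_vs.span_induct_alt) (auto simp: fun_scale_def x)
    then have "proj_point x \<in> common_zeros (I1 d S)"
      using x(1) unfolding common_zeros_def by blast
    then have "proj_point x \<in> proj_point ` S" unfolding zeros .
    then obtain s where "s \<in> S" "span {x} = span {s}" by (auto simp: proj_point_def)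
    then show "\<exists>s\<in>S. \<exists>c. x = c *\<^sub>R s"
      using span_base[of x "{x}"] by (auto simp: span_singleton)
  next
    fix s v assume sv: "s \<in> S" "v \<bullet> s = 0" "v \<noteq> 0"
    show "\<exists>b\<in>B. grad b s v \<noteq> 0"
    proof (rule ccontr)
      assume "\<not> ?thesis"
      then have 0: "grad b s v = 0" if "b \<in> B" for b using that by blast
      \<comment> \<open>The derivative vanishing on a basis vanishes on all of \<open>I1 d S\<close>; membership in \<open>forms d\<close> is carried along because differentiation is additive only there.\<close>
      have "q \<in> forms d \<and> grad q s v = 0" if "q \<in> I1 d S" for q
        using subsetD[OF B(2) that]
      proof (induction rule: fun_vs.span_induct_alt)
        case base
        show ?case
          using fun_vs.subspace_0[OF subspace_forms[of d]] frechet_derivative_const[of 0 s] 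
          by (simp add: zero_fun_def)
      next
        case (step c b q)
        then have b: "fun_scale c b \<in> forms d" "b \<in> forms d" 
          using fun_vs.subspace_scale[OF subspace_forms] Bf(1) by blast+
        have q: "q \<in> forms d" using step by blast
        have "grad (fun_scale c b + q) s v = 0"
          unfolding grad_add[OF b(1) q] grad_scale[OF b(2)] using 0 step by simp
        then show ?case
          using fun_vs.subspace_add[OF subspace_forms b(1) q] by blast
      qed
      then show False using ex_transversal_gradient[OF assms sv] by blast
    qed
  qed auto
  then obtain e where e: "e > 0" "\<And>x. e * \<bar>w x\<bar> \<le> p x" unfolding p_def by blast
  have pB: "p = (\<Sum>b\<in>B. b * b)"
    by (simp add: p_def fun_eq_iff sum_fun_apply power2_eq_square)
  have square: "b * b \<in> forms (2 * d)" if "b \<in> B" for b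
  proof -
    have "b \<in> forms d" using Bf(1) that by (rule subsetD)
    then have "b * b \<in> forms (d + d)" using \<open>b \<in> forms d\<close> by (rule forms_times)
    then show ?thesis by (simp only: mult_2)
  qed
  have p: "p \<in> forms (2 * d)"
    unfolding pB using square by (rule fun_vs.subspace_sum[OF subspace_forms])
  have p0: "p s = 0" if "s \<in> S" for s
    using that Bf(2) by (auto simp: p_def vanishing_on_def intro!: sum.neutral)
  have "p \<in> Pos_at d S"
    using p p0 by (auto simp: Pos_at_def Pos_def vanishing_on_def p_def sum_nonneg)
  moreover have "p + fun_scale e w \<in> Pos_at d S"
  proof -
    have "p + fun_scale e w \<in> forms (2 * d)"
      by (intro fun_vs.subspace_add[OF subspace_forms p] fun_vs.subspace_scale[OF subspace_forms w])
    moreover have "(p + fun_scale e w) x \<ge> 0" for x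
    proof -
      have "- (e * w x) \<le> e * \<bar>w x\<bar>"
        using e(1) by (metis abs_ge_minus_self abs_mult abs_of_pos)
      then show ?thesis using e(2)[of x] by (simp add: fun_scale_def)
    qed
    ultimately show ?thesis
      using p0 w0 by (auto simp: Pos_at_def Pos_def vanishing_on_def fun_scale_def)
  qed
  ultimately have "fun_scale (1 / e) (p + fun_scale e w - p) \<in> fun_vs.span (Pos_at d S)"
    by (intro fun_vs.span_scale fun_vs.span_diff fun_vs.span_base)
  moreover have "fun_scale (1 / e) (p + fun_scale e w - p) = w"
    using e(1) by (simp add: fun_eq_iff fun_scale_def)
  ultimately show "w \<in> fun_vs.span (Pos_at d S)" by simp
qed

text \<open>
  If a sum of squares vanishes at a point then so does every summand. The \<open>q i\<close> therefore lie in
  \<open>I1 d S\<close>, and their squares are combinations of products of pairs of basis elements.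
\<close>

lemma dim_Sq_at_le:
  "cone_dim (Sq_at d S) \<le> (fun_vs.dim (I1 d S) + 1) choose 2"
proof -
  obtain B where finB: "finite B" and B: "B \<subseteq> I1 d S" "I1 d S \<subseteq> fun_vs.span B"
      "card B = fun_vs.dim (I1 d S)"
    by (rule I1_finite_basis)
  let ?P = "{a * b | a b. a \<in> B \<and> b \<in> B}"
  have "?P = (\<lambda>(a, b). a * b) ` (B \<times> B)" by auto
  then have finP: "finite ?P" using finB by simp
  have "Sq_at d S \<subseteq> fun_vs.span ?P"
  proof
    fix p assume p: "p \<in> Sq_at d S"
    then obtain N :: nat and q where q: "\<And>i. i < N \<Longrightarrow> q i \<in> forms d"
        and pq: "p = (\<lambda>x. \<Sum>i<N. (q i x)\<^sup>2)"
      by (auto simp: Sq_at_def Sq_def)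
    have "q i * q i \<in> fun_vs.span ?P" if i: "i < N" for i
    proof -
      have "q i s = 0" if "s \<in> S" for s
      proof -
        have "(\<Sum>i<N. (q i s)\<^sup>2) = 0"
          using p that by (simp add: Sq_at_def vanishing_on_def pq)
        then show ?thesis using i by (simp add: sum_nonneg_eq_0_iff)
      qed
      then have "q i \<in> I1 d S" using q[OF i] by (simp add: I1_def vanishing_on_def)
      then have "q i \<in> fun_vs.span B" using B(2) by blast
      then show ?thesis
        by (rule times_in_span[OF _ \<open>q i \<in> fun_vs.span B\<close>]) (auto intro: fun_vs.span_base)
    qed
    then have "(\<Sum>i<N. q i * q i) \<in> fun_vs.span ?P" by (intro fun_vs.span_sum) auto
    moreover have "(\<Sum>i<N. q i * q i) = p"
      by (simp add: pq fun_eq_iff sum_fun_apply power2_eq_square)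
    ultimately show "p \<in> fun_vs.span ?P" by simp
  qed
  then have "cone_dim (Sq_at d S) \<le> card ?P"
    using finP by (simp add: cone_dim_def fun_vs.dim_le_card)
  also have "\<dots> \<le> (fun_vs.dim (I1 d S) + 1) choose 2"
    using card_pairwise_products_le[OF finB] B(3) by simp
  finally show ?thesis .
qed

theorem theorem5p1:
  fixes S :: "(real ^ 'n::finite) set" and d k :: nat
  assumes "d \<ge> 1"
    and "d_independent d S"
    and "card S = k"
  shows "int (cone_dim (Pos_at d S))
           \<ge> int ((CARD('n) + 2 * d - 1) choose (2 * d)) - int (k * CARD('n))
         \<and> cone_dim (Sq_at d S)
           \<le> ((((CARD('n) + d - 1) choose d) - k + 1) choose 2)"
proof
  have d: "d > 0" using assms(1) by simp
  have "finite S" using assms(2) by (simp add: d_independent_def projective_points_def)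
  have "fun_vs.dim (singular_forms (2 * d) S) \<le> fun_vs.dim (Pos_at d S)"
    using singular_forms_subset_span_Pos_at[OF d assms(2)]
    by (rule fun_vs.dim_mono_finite_span[OF _ _ finite_monomials[of "2 * d"]])
      (auto simp: Pos_at_def Pos_def forms_def)
  then have "(CARD('n) + 2 * d - 1) choose (2 * d) \<le> cone_dim (Pos_at d S) + k * CARD('n)"
    using dim_singular_forms_ge[OF \<open>finite S\<close>, of "2 * d"] assms(3)
    by (simp add: dim_forms cone_dim_def)
  then show "int (cone_dim (Pos_at d S))
      \<ge> int ((CARD('n) + 2 * d - 1) choose (2 * d)) - int (k * CARD('n))"
    by linarith
  have "fun_vs.dim (I1 d S) = ((CARD('n) + d - 1) choose d) - k"
    using dim_I1[OF d assms(2)] assms(3) by (simp add: dim_forms)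
  then show "cone_dim (Sq_at d S) \<le> ((((CARD('n) + d - 1) choose d) - k + 1) choose 2)"
    using dim_Sq_at_le[of d S] by simp
qed

end
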